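(* Let $P \subseteq \mathbb{R}^d$ be a full-dimensional polytope. Then $L_{P^\circ}(s) = L_{P^\circ}(\lceil s \rceil)$ for all real $s \ge 0$ if and only if $P$ can be written as $$P = \bigcap_{i=1}^n \{x \in \mathbb{R}^d \mid \langle a_i, x\rangle \le b_i\},$$ with $a_i \in \mathbb{R}^d$, where every $b_i$ is either $0$ or $1$ and $a_i \in \mathbb{Z}^d$ whenever $b_i = 1$. Consequently, $L_P(s) = L_P(\lfloor s\rfloor)$ for all $s \ge 0$ if and only if $L_{P^\circ}(s) = L_{P^\circ}(\lceil s \rceil)$ for all $s \ge 0$.
   Context: $P^\circ$ denotes the interior of $P$. For a set $Q \subseteq \mathbb{R}^d$ and real $s > 0$, let $L_Q(s) = \#(sQ \cap \mathbb{Z}^d)$, where $sQ = \{sx \mid x \in Q\}$ and $\#$ denotes cardinality; by convention $L_Q(0) = 1$. *)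

theory Defs
  imports "HOL-Analysis.Analysis"
begin

definition integer_lattice :: "(real ^ 'n) set" where
  "integer_lattice = {x. \<forall>j. x $ j \<in> \<int>}"

text \<open>
  The value at \<open>0\<close> is a convention, independent of \<open>Q\<close>. The function is meant for
  \<open>s \<ge> 0\<close> and bounded \<open>Q\<close>; boundedness makes the intersection below finite, so that
  \<^const>\<open>card\<close> really counts its elements.
\<close>
definition lattice_count :: "(real ^ 'n) set \<Rightarrow> real \<Rightarrow> nat" where
  "lattice_count Q s =
     (if s = 0 then 1 else card ((\<lambda>x. s *\<^sub>R x) ` Q \<inter> integer_lattice))"

end

theory Submission imports Defs begin

text \<open>
  If \<open>P\<close> is cut out by inequalities with right-hand sides \<open>0\<close> or \<open>1\<close> and integral normals in the
  latter case, a lattice point enters a dilate of \<open>P\<close> (or leaves its interior) only at integral times.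
  Conversely, each of the two conditions on the counting functions forces \<open>0 \<in> P\<close>. The dilates
  then form a nested family, so that equal counts mean equal sets of lattice points. Hence, if
  \<open>a \<bullet> x \<le> 1\<close> defines a facet, every lattice point \<open>z\<close> in the open cone over the
  facet, which enters the dilates at time \<open>a \<bullet> z\<close>, has \<open>a \<bullet> z \<in> \<int>\<close>. An open cone
  contains some lattice point \<open>z\<close> together with all \<open>z + e\<^sub>j\<close>, and so \<open>a\<close> is integral.
\<close>

section \<open>Lattice points in dilates and their finiteness\<close>

text \<open>Testing \<open>(1 / s) *\<^sub>R z\<close> keeps the lattice points themselves as
  elements, so that the sets for different \<open>s\<close> can be compared by inclusion. At
  \<open>s = 0\<close> division by zero would give the whole lattice or the empty set, hence the
  side conditions \<open>s \<noteq> 0\<close>.\<close>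

definition dilate_lattice_points :: "(real ^ 'n) set \<Rightarrow> real \<Rightarrow> (real ^ 'n) set" where
  "dilate_lattice_points Q s = {z \<in> integer_lattice. (1 / s) *\<^sub>R z \<in> Q}"

lemma lattice_count_eq_card:
  assumes "s \<noteq> 0"
  shows "lattice_count Q s = card (dilate_lattice_points Q s)"
proof -
  have "(\<lambda>x. s *\<^sub>R x) ` Q \<inter> integer_lattice = dilate_lattice_points Q s"
  proof (intro set_eqI iffI)
    fix z assume "z \<in> dilate_lattice_points Q s"
    then show "z \<in> (\<lambda>x. s *\<^sub>R x) ` Q \<inter> integer_lattice"
      using assms unfolding dilate_lattice_points_def
      by (auto intro!: image_eqI[of _ _ "(1 / s) *\<^sub>R z"])
  qed (use assms in \<open>auto simp: dilate_lattice_points_def\<close>)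
  then show ?thesis using assms by (simp add: lattice_count_def)
qed

lemma inner_integer_lattice:
  assumes "a \<in> integer_lattice" "z \<in> integer_lattice"
  shows "a \<bullet> z \<in> \<int>"
  using assms by (auto simp: inner_vec_def integer_lattice_def intro!: Ints_mult)

text \<open>Each coordinate ranges over a finite segment of integers. Finiteness is what later turns
  inclusion plus equal cardinality into equality of sets.\<close>

lemma finite_integer_lattice_Int_bounded:
  fixes B :: "(real ^ 'n) set"
  assumes "bounded B"
  shows "finite (integer_lattice \<inter> B)"
proof -
  obtain M where M: "\<And>x. x \<in> B \<Longrightarrow> norm x \<le> M"
    using assms by (auto simp: bounded_iff)
  define T where "T = {x \<in> \<int>. - M \<le> x \<and> x \<le> (M::real)}"
  have "finite T" unfolding T_def by (rule finite_int_segment)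
  then have "finite (PiE (UNIV :: 'n set) (\<lambda>_. T))" by (intro finite_PiE) auto
  moreover have "vec_nth ` (integer_lattice \<inter> B) \<subseteq> PiE UNIV (\<lambda>_. T)"
  proof clarify
    fix x :: "real ^ 'n" assume x: "x \<in> integer_lattice" "x \<in> B"
    have "\<bar>x $ j\<bar> \<le> M" for j
      using component_le_norm_cart[of x j] M[OF x(2)] by linarith
    then show "vec_nth x \<in> PiE UNIV (\<lambda>_. T)"
      using x(1) by (auto simp: T_def integer_lattice_def abs_le_iff minus_le_iff)
  qed
  ultimately have "finite (vec_nth ` (integer_lattice \<inter> B))" by (rule rev_finite_subset)
  then show ?thesis
    by (rule finite_imageD) (simp add: inj_on_def vec_nth_inject)
qed

lemma finite_dilate_lattice_points:
  assumes "bounded Q" "s \<noteq> 0"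
  shows "finite (dilate_lattice_points Q s)"
proof (rule finite_subset)
  show "dilate_lattice_points Q s \<subseteq> integer_lattice \<inter> (\<lambda>x. s *\<^sub>R x) ` Q"
    using assms(2) by (auto simp: dilate_lattice_points_def
        intro!: image_eqI[of _ _ "(1 / s) *\<^sub>R _"])
  show "finite (integer_lattice \<inter> (\<lambda>x. s *\<^sub>R x) ` Q)"
    by (intro finite_integer_lattice_Int_bounded bounded_scaling assms)
qed

lemma integer_lattice_norm_less_1:
  assumes "z \<in> integer_lattice" "norm z < 1"
  shows "z = 0"
proof -
  have "z $ j = 0" for j
  proof -
    have "\<bar>z $ j\<bar> < 1" using component_le_norm_cart[of z j] assms(2) by linarith
    moreover have "z $ j \<in> \<int>" using assms(1) by (auto simp: integer_lattice_def)
    ultimately show ?thesis using Ints_nonzero_abs_less1 by blast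
  qed
  then show ?thesis by (simp add: vec_eq_iff)
qed

section \<open>Integrality tested on open cones\<close>

text \<open>Dilating by a large \<open>t\<close> makes room in the ball around
  \<open>t *\<^sub>R w\<close> for its coordinatewise rounding and for all unit translates of
  that.\<close>

lemma open_contains_scaled_integer_vectors:
  fixes U :: "(real ^ 'n) set"
  assumes "open U" "w \<in> U"
  obtains t z where "t > 0" "z \<in> integer_lattice" "(1 / t) *\<^sub>R z \<in> U"
    "\<And>j. (1 / t) *\<^sub>R (z + axis j 1) \<in> U"
proof -
  obtain r where r: "r > 0" "ball w r \<subseteq> U" using assms by (meson openE)
  define d where "d = real CARD('n)"
  \<comment> \<open>Rounding costs at most \<open>d\<close> in the l1 norm and a unit step costs 1;
    \<open>d + 2\<close> keeps the total strictly below \<open>t * r\<close>.\<close>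
  define t where "t = (d + 2) / r"
  define z :: "real ^ 'n" where "z = (\<chi> i. of_int \<lfloor>t * w $ i\<rfloor>)"
  have t: "t > 0" using r by (simp add: t_def d_def)
  have "norm (z - t *\<^sub>R w) \<le> (\<Sum>i\<in>UNIV. \<bar>(z - t *\<^sub>R w) $ i\<bar>)" by (rule norm_le_l1_cart)
  also have "\<dots> \<le> (\<Sum>i\<in>(UNIV::'n set). 1)"
    by (intro sum_mono) (simp add: z_def abs_le_iff, linarith)
  finally have z: "norm (z - t *\<^sub>R w) \<le> d" by (simp add: d_def)
  have *: "(1 / t) *\<^sub>R y \<in> U" if "norm (y - z) \<le> 1" for y
  proof -
    have "norm (y - t *\<^sub>R w) \<le> norm (y - z) + norm (z - t *\<^sub>R w)"
      using norm_triangle_ineq[of "y - z" "z - t *\<^sub>R w"] by simp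
    with z that have "norm (y - t *\<^sub>R w) < d + 2" by linarith
    also have "d + 2 = t * r" using r by (simp add: t_def)
    finally have "norm (y - t *\<^sub>R w) / t < r" using t by (simp add: field_simps)
    moreover have "(1 / t) *\<^sub>R y - w = (1 / t) *\<^sub>R (y - t *\<^sub>R w)"
      using t by (simp add: algebra_simps)
    ultimately have "dist ((1 / t) *\<^sub>R y) w < r"
      using t by (simp add: dist_norm)
    then show ?thesis using r by (auto simp: dist_commute)
  qed
  show thesis
  proof
    show "z \<in> integer_lattice" by (simp add: z_def integer_lattice_def)
  qed (use t in \<open>auto intro!: *\<close>)
qed

text \<open>\<open>a $ j\<close> is the difference of the values of the linear form \<open>a\<close>
  at \<open>z + axis j 1\<close> and at \<open>z\<close>; scaling by \<open>t\<close> brings both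
  points into the cone.\<close>

lemma integer_lattice_if_Ints_on_open_cone:
  assumes "open K" "w \<in> K"
    and cone: "\<And>x t. x \<in> K \<Longrightarrow> t > 0 \<Longrightarrow> t *\<^sub>R x \<in> K"
    and Ints: "\<And>z. z \<in> K \<Longrightarrow> z \<in> integer_lattice \<Longrightarrow> a \<bullet> z \<in> \<int>"
  shows "a \<in> integer_lattice"
proof -
  obtain t z where t: "t > 0" and z: "z \<in> integer_lattice" "(1 / t) *\<^sub>R z \<in> K"
    and zj: "\<And>j. (1 / t) *\<^sub>R (z + axis j 1) \<in> K"
    using open_contains_scaled_integer_vectors[OF assms(1,2)] by blast
  have K: "y \<in> K" if "(1 / t) *\<^sub>R y \<in> K" for y
    using cone[OF that t] t by simp
  have "a $ j \<in> \<int>" for j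
  proof -
    have "z + axis j 1 \<in> integer_lattice"
      using z(1) by (auto simp: integer_lattice_def axis_def)
    then have "a \<bullet> (z + axis j 1) - a \<bullet> z \<in> \<int>"
      using Ints K z zj by (intro Ints_diff) auto
    then show ?thesis by (simp add: inner_add_right inner_axis)
  qed
  then show ?thesis by (simp add: integer_lattice_def)
qed

section \<open>From the inequalities to the counts\<close>

text \<open>Full-dimensional lattice polytopes having such a system with every
  \<open>b i = 1\<close> are the reflexive ones. Redundant inequalities and zero normals are
  allowed.\<close>

definition semi_reflexive_system ::
  "(real ^ 'n) set \<Rightarrow> nat \<Rightarrow> (nat \<Rightarrow> real ^ 'n) \<Rightarrow> (nat \<Rightarrow> real) \<Rightarrow> bool" where
  "semi_reflexive_system P n a b \<longleftrightarrow>
     P = (\<Inter>i\<in>{1..n}. {x. a i \<bullet> x \<le> b i}) \<and>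
     (\<forall>i\<in>{1..n}. (b i = 0 \<or> b i = 1) \<and> (b i = 1 \<longrightarrow> a i \<in> integer_lattice))"

text \<open>Interior commutes with finite intersections. A zero normal gives the whole space because
  \<open>0 \<le> b i\<close>, so it must not contribute a strict inequality.\<close>

lemma interior_INT_halfspaces:
  assumes "finite I" "\<And>i. i \<in> I \<Longrightarrow> 0 \<le> b i"
  shows "interior (\<Inter>i\<in>I. {x. a i \<bullet> x \<le> b i}) = {x. \<forall>i\<in>I. a i \<noteq> 0 \<longrightarrow> a i \<bullet> x < b i}"
  using assms
proof (induction I rule: finite_induct)
  case (insert i I)
  have "interior {x. a i \<bullet> x \<le> b i} = {x. a i \<noteq> 0 \<longrightarrow> a i \<bullet> x < b i}"
    using insert.prems[of i] by (cases "a i = 0") auto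
  then show ?case using insert by auto
qed auto

lemma Ints_le_iff_le_floor: "x \<in> \<int> \<Longrightarrow> x \<le> s \<longleftrightarrow> x \<le> real_of_int \<lfloor>s\<rfloor>"
  by (auto elim!: Ints_cases simp: le_floor_iff)

lemma Ints_less_iff_less_ceiling: "x \<in> \<int> \<Longrightarrow> x < s \<longleftrightarrow> x < real_of_int \<lceil>s\<rceil>"
  by (auto elim!: Ints_cases simp: less_ceiling_iff)

text \<open>The time enters only through \<open>a i \<bullet> z < b i * s\<close>: for
  \<open>b i = 0\<close> it drops out, and for \<open>b i = 1\<close> the left side is an integer,
  so \<open>s\<close> may be rounded up.\<close>

lemma semi_reflexive_imp_interior_count:
  assumes "semi_reflexive_system P n a b" "s \<ge> 0"
  shows "lattice_count (interior P) s = lattice_count (interior P) (of_int \<lceil>s\<rceil>)"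
proof (cases "s = 0")
  case False
  \<comment> \<open>A positive \<open>s\<close> has a positive ceiling, so the conventional value at
    0 occurs only for \<open>s = 0\<close>, on both sides alike.\<close>
  with assms(2) have s: "s > 0" "real_of_int \<lceil>s\<rceil> > 0" by auto
  have b: "\<And>i. i \<in> {1..n} \<Longrightarrow> b i = 0 \<or> b i = 1 \<and> a i \<in> integer_lattice"
    using assms(1) unfolding semi_reflexive_system_def by blast
  then have "interior P = {x. \<forall>i\<in>{1..n}. a i \<noteq> 0 \<longrightarrow> a i \<bullet> x < b i}"
    using assms(1) interior_INT_halfspaces[of "{1..n}" b a]
    unfolding semi_reflexive_system_def by force
  moreover have "a i \<bullet> z < b i * s \<longleftrightarrow> a i \<bullet> z < b i * real_of_int \<lceil>s\<rceil>"
    if "i \<in> {1..n}" "z \<in> integer_lattice" for i z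
    using b[OF that(1)] Ints_less_iff_less_ceiling[OF inner_integer_lattice[OF _ that(2)], of "a i" s]
    by auto
  ultimately have "dilate_lattice_points (interior P) s =
      dilate_lattice_points (interior P) (of_int \<lceil>s\<rceil>)"
    using s by (auto simp: dilate_lattice_points_def pos_divide_less_eq)
  then show ?thesis using s by (metis lattice_count_eq_card order_less_irrefl)
qed simp

text \<open>Weak inequalities allow rounding \<open>s\<close> down. The floor can be 0 while
  \<open>s > 0\<close>; the count must then be the conventional 1, which is where boundedness
  enters.\<close>

lemma semi_reflexive_imp_count:
  assumes "semi_reflexive_system P n a b" "bounded P" "s \<ge> 0"
  shows "lattice_count P s = lattice_count P (of_int \<lfloor>s\<rfloor>)"
proof -
  have b: "\<And>i. i \<in> {1..n} \<Longrightarrow> b i = 0 \<or> b i = 1 \<and> a i \<in> integer_lattice"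
    and P: "P = {x. \<forall>i\<in>{1..n}. a i \<bullet> x \<le> b i}"
    using assms(1) unfolding semi_reflexive_system_def by blast+
  have floor: "a i \<bullet> z \<le> b i * s \<longleftrightarrow> a i \<bullet> z \<le> b i * real_of_int \<lfloor>s\<rfloor>"
    if "i \<in> {1..n}" "z \<in> integer_lattice" for i z
    using b[OF that(1)] Ints_le_iff_le_floor[OF inner_integer_lattice[OF _ that(2)], of "a i" s]
    by auto
  consider "s = 0" | "0 < s" "s < 1" | "s \<ge> 1" using assms(3) by linarith
  then show ?thesis
  proof cases
    case 2
    then have s0: "\<lfloor>s\<rfloor> = 0" by (simp add: floor_eq_iff)
    have "z = 0" if z: "z \<in> dilate_lattice_points P s" for z
    proof (rule ccontr)
      assume "z \<noteq> 0"
      obtain M where M: "\<And>x. x \<in> P \<Longrightarrow> norm x \<le> M"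
        using assms(2) by (auto simp: bounded_iff)
      \<comment> \<open>Floor 0 turns every inequality into \<open>a i \<bullet> z \<le> 0\<close>,
        so the whole ray through \<open>z\<close> would lie in \<open>P\<close>; its point of norm
        \<open>\<bar>M\<bar> + 1\<close> violates the bound.\<close>
      have "a i \<bullet> z \<le> 0" if "i \<in> {1..n}" for i
        using z that floor[of i z] s0 2(1)
        by (auto simp: dilate_lattice_points_def P pos_divide_le_eq)
      then have "a i \<bullet> (t *\<^sub>R z) \<le> b i" if "t \<ge> 0" "i \<in> {1..n}" for t i
        using b[OF that(2)] mult_nonneg_nonpos[OF that(1), of "a i \<bullet> z"] that by auto
      then have "t *\<^sub>R z \<in> P" if "t \<ge> 0" for t
        using that by (simp add: P)
      from M[OF this, of "(\<bar>M\<bar> + 1) / norm z"] \<open>z \<noteq> 0\<close> show False by simp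
    qed
    moreover have "0 \<in> dilate_lattice_points P s"
      using b by (fastforce simp: dilate_lattice_points_def integer_lattice_def P)
    ultimately have "dilate_lattice_points P s = {0}" by blast
    then show ?thesis using 2 s0 by (simp add: lattice_count_eq_card) (simp add: lattice_count_def)
  next
    case 3
    then have s: "s > 0" "real_of_int \<lfloor>s\<rfloor> > 0" by auto
    have "dilate_lattice_points P s = dilate_lattice_points P (of_int \<lfloor>s\<rfloor>)"
      using s floor by (auto simp: dilate_lattice_points_def P pos_divide_le_eq)
    then show ?thesis using s by (metis lattice_count_eq_card order_less_irrefl)
  qed simp
qed

section \<open>Normalised facet inequalities\<close>

text \<open>The vector \<open>w\<close> lies in the relative interior of the facet on \<open>a i \<bullet> x = 1\<close>.\<close>
lemma full_dim_polyhedron_facet_system: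
  fixes P :: "(real ^ 'n) set"
  assumes "polyhedron P" "aff_dim P = int CARD('n)" "0 \<in> P"
  obtains n :: nat and a :: "nat \<Rightarrow> real ^ 'n" and b :: "nat \<Rightarrow> real"
  where "P = (\<Inter>i\<in>{1..n}. {x. a i \<bullet> x \<le> b i})"
    "interior P = {x. \<forall>i\<in>{1..n}. a i \<bullet> x < b i}"
    "\<forall>i\<in>{1..n}. b i = 0 \<or> b i = 1"
    "\<forall>i\<in>{1..n}. b i = 1 \<longrightarrow>
       (\<exists>w. a i \<bullet> w = 1 \<and> (\<forall>j\<in>{1..n} - {i}. a j \<bullet> w < b j))"
proof -
  have hull: "affine hull P = UNIV" using assms(2) aff_dim_eq_full[of P] by simp
  \<comment> \<open>Irredundancy of \<open>F\<close> yields both the strict description of the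
    interior and a point on each facet.\<close>
  obtain F where F: "finite F" "P = affine hull P \<inter> \<Inter>F"
    and half: "\<forall>h\<in>F. \<exists>a b. a \<noteq> 0 \<and> h = {x. a \<bullet> x \<le> b}"
    and minimal: "\<And>F'. F' \<subset> F \<Longrightarrow> P \<subset> affine hull P \<inter> \<Inter>F'"
    using assms(1) unfolding polyhedron_Int_affine_minimal by blast
  from half obtain c d where cd: "\<And>h. h \<in> F \<Longrightarrow> c h \<noteq> 0 \<and> h = {x. c h \<bullet> x \<le> d h}"
    by metis
  have P: "P = \<Inter>F" using F(2) hull by simp
  have memP: "x \<in> P \<longleftrightarrow> (\<forall>h\<in>F. c h \<bullet> x \<le> d h)" for x using P cd by blast
  have "interior P = rel_interior P"
    using interior_rel_interior[of P] assms(2) by simp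
  also have "\<dots> = {x \<in> P. \<forall>h\<in>F. c h \<bullet> x < d h}"
    by (rule rel_interior_polyhedron_explicit[OF F cd minimal])
  finally have int: "interior P = {x. \<forall>h\<in>F. c h \<bullet> x < d h}"
    using memP by (auto intro: less_imp_le)
  have d0: "d h \<ge> 0" if "h \<in> F" for h using assms(3) memP that by force
  have "interior P \<noteq> {}"
    using assms(2) aff_dim_eq_full[of P] interior_rel_interior[of P] polyhedron_imp_convex[OF assms(1)]
      rel_interior_eq_empty[of P] assms(3) by auto
  then obtain p where p: "\<And>h. h \<in> F \<Longrightarrow> c h \<bullet> p < d h" using int by blast
  \<comment> \<open>Dropping \<open>h\<close> admits a point \<open>y\<close> that violates only
    \<open>h\<close>. The segment from the interior point \<open>p\<close> to \<open>y\<close> meets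
    the hyperplane of \<open>h\<close> at parameter \<open>u < 1\<close>; the other inequalities are
    strict there, being strict at \<open>p\<close> and weak at \<open>y\<close>.\<close>
  have facet: "\<exists>w. c h \<bullet> w = d h \<and> (\<forall>g\<in>F - {h}. c g \<bullet> w < d g)" if h: "h \<in> F" for h
  proof -
    have "P \<subset> \<Inter>(F - {h})" using minimal[of "F - {h}"] h hull by auto
    then obtain y where y: "y \<in> \<Inter>(F - {h})" "y \<notin> P" by blast
    have yg: "c g \<bullet> y \<le> d g" if "g \<in> F - {h}" for g using y(1) that cd by blast
    have yh: "c h \<bullet> y > d h" using y(2) yg memP h by force
    define u where "u = (d h - c h \<bullet> p) / (c h \<bullet> y - c h \<bullet> p)"
    have u: "0 < u" "u < 1" using yh p[OF h] by (auto simp: u_def divide_simps)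
    define w where "w = (1 - u) *\<^sub>R p + u *\<^sub>R y"
    have "c h \<bullet> w = c h \<bullet> p + u * (c h \<bullet> y - c h \<bullet> p)"
      by (simp add: w_def algebra_simps)
    also have "\<dots> = d h" using yh p[OF h] by (simp add: u_def)
    finally have "c h \<bullet> w = d h" .
    moreover have "c g \<bullet> w < d g" if g: "g \<in> F - {h}" for g
    proof -
      have "(1 - u) * (c g \<bullet> p) < (1 - u) * d g" using u p g by simp
      moreover have "u * (c g \<bullet> y) \<le> u * d g" using u yg[OF g] by simp
      ultimately have "c g \<bullet> w < (1 - u) * d g + u * d g" by (simp add: w_def inner_add_right)
      then show ?thesis by (simp add: algebra_simps)
    qed
    ultimately show ?thesis by blast
  qed
  obtain f where f: "bij_betw f {1..card F} F" using ex_bij_betw_nat_finite_1[OF F(1)] by blast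
  then have fF: "f ` {1..card F} = F" and inj: "inj_on f {1..card F}"
    by (auto simp: bij_betw_def)
  \<comment> \<open>Rescaling by \<open>k h\<close> makes the right-hand side 0 or 1; the factor is
    positive since \<open>0 \<in> P\<close> forces \<open>d h \<ge> 0\<close>.\<close>
  define k where "k h = (if d h = 0 then 1 else 1 / d h)" for h
  define a where "a i = k (f i) *\<^sub>R c (f i)" for i
  define b where "b i = k (f i) * d (f i)" for i
  have k: "k h > 0" if "h \<in> F" for h using d0[OF that] by (auto simp: k_def)
  have fi: "f i \<in> F" if "i \<in> {1..card F}" for i using fF that by blast
  have le: "a i \<bullet> x \<le> b i \<longleftrightarrow> c (f i) \<bullet> x \<le> d (f i)"
    and lt: "a i \<bullet> x < b i \<longleftrightarrow> c (f i) \<bullet> x < d (f i)" if "i \<in> {1..card F}" for i x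
    using k[OF fi[OF that]] by (auto simp: a_def b_def)
  have ballF: "(\<forall>h\<in>F. Q h) \<longleftrightarrow> (\<forall>i\<in>{1..card F}. Q (f i))" for Q
    using ball_simps(9)[of f "{1..card F}" Q] unfolding fF .
  have "x \<in> P \<longleftrightarrow> (\<forall>i\<in>{1..card F}. a i \<bullet> x \<le> b i)" for x
    unfolding memP ballF by (intro ball_cong refl le[symmetric])
  then have Pab: "P = (\<Inter>i\<in>{1..card F}. {x. a i \<bullet> x \<le> b i})" by blast
  have "x \<in> interior P \<longleftrightarrow> (\<forall>i\<in>{1..card F}. a i \<bullet> x < b i)" for x
    unfolding int mem_Collect_eq ballF by (intro ball_cong refl lt[symmetric])
  then have intab: "interior P = {x. \<forall>i\<in>{1..card F}. a i \<bullet> x < b i}" by blast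
  show thesis
  proof (rule that[OF Pab intab])
    show "\<forall>i\<in>{1..card F}. b i = 0 \<or> b i = 1" by (auto simp: b_def k_def)
    have "\<exists>w. a i \<bullet> w = 1 \<and> (\<forall>j\<in>{1..card F} - {i}. a j \<bullet> w < b j)"
      if i: "i \<in> {1..card F}" "b i = 1" for i
    proof -
      obtain w where w: "c (f i) \<bullet> w = d (f i)" "\<And>g. g \<in> F - {f i} \<Longrightarrow> c g \<bullet> w < d g"
        using facet[OF fi[OF i(1)]] by blast
      have "a i \<bullet> w = 1" using w(1) i(2) by (simp add: a_def b_def)
      moreover have "a j \<bullet> w < b j" if j: "j \<in> {1..card F} - {i}" for j
      proof -
        have "f j \<in> F - {f i}" using j fi i(1) inj by (auto dest: inj_onD)
        then show ?thesis using w(2) lt j by blast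
      qed
      ultimately show ?thesis by blast
    qed
    then show "\<forall>i\<in>{1..card F}. b i = 1 \<longrightarrow>
        (\<exists>w. a i \<bullet> w = 1 \<and> (\<forall>j\<in>{1..card F} - {i}. a j \<bullet> w < b j))" by simp
  qed
qed

section \<open>From integral entry times to integral normals\<close>

text \<open>Shared by both necessity directions: \<open>entry\<close> isolates what the counts must
  supply. It is applied to lattice points over the relative interior of a facet, whose entry time is
  \<open>a i \<bullet> z\<close>.\<close>

lemma semi_reflexive_if_integer_entry_times:
  fixes P :: "(real ^ 'n) set"
  assumes "polyhedron P" "aff_dim P = int CARD('n)" "0 \<in> P"
    and entry: "\<And>z r. \<lbrakk>z \<in> integer_lattice; r > 0;
        \<And>s. s > 0 \<Longrightarrow> (1 / s) *\<^sub>R z \<in> P \<longleftrightarrow> r \<le> s;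
        \<And>s. s > 0 \<Longrightarrow> (1 / s) *\<^sub>R z \<in> interior P \<longleftrightarrow> r < s\<rbrakk> \<Longrightarrow> r \<in> \<int>"
  shows "\<exists>n a b. semi_reflexive_system P n a b"
proof -
  obtain n :: nat and a :: "nat \<Rightarrow> real ^ 'n" and b :: "nat \<Rightarrow> real"
    where P: "P = (\<Inter>i\<in>{1..n}. {x. a i \<bullet> x \<le> b i})"
    and int: "interior P = {x. \<forall>i\<in>{1..n}. a i \<bullet> x < b i}"
    and b: "\<forall>i\<in>{1..n}. b i = 0 \<or> b i = 1"
    and facet: "\<forall>i\<in>{1..n}. b i = 1 \<longrightarrow>
       (\<exists>w. a i \<bullet> w = 1 \<and> (\<forall>j\<in>{1..n} - {i}. a j \<bullet> w < b j))"
    by (rule full_dim_polyhedron_facet_system[OF assms(1-3)]) (rule that)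
  have "a i \<in> integer_lattice" if i: "i \<in> {1..n}" "b i = 1" for i
  proof -
    obtain w where w: "a i \<bullet> w = 1" "\<And>j. j \<in> {1..n} - {i} \<Longrightarrow> a j \<bullet> w < b j"
      using facet i by blast
    \<comment> \<open>The open cone over the relative interior of the facet: the strict inequalities
      for \<open>z / (a i \<bullet> z)\<close>, multiplied out.\<close>
    define K where "K = {z. 0 < a i \<bullet> z} \<inter>
      (\<Inter>j\<in>{1..n} - {i}. {z. a j \<bullet> z < b j * (a i \<bullet> z)})"
    show ?thesis
    proof (rule integer_lattice_if_Ints_on_open_cone)
      show "open K" unfolding K_def
        by (intro open_Int open_INT ballI open_Collect_less continuous_intros) auto
      show "w \<in> K" using w by (auto simp: K_def)
      show "t *\<^sub>R x \<in> K" if "x \<in> K" "t > 0" for x t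
        using that by (auto simp: K_def mult.left_commute[of _ t])
    next
      fix z assume z: "z \<in> K" "z \<in> integer_lattice"
      let ?r = "a i \<bullet> z"
      have r: "?r > 0" using z by (auto simp: K_def)
      \<comment> \<open>Since \<open>b j \<ge> 0\<close>, the other inequalities hold strictly from
        time \<open>?r\<close> on, so inequality \<open>i\<close> alone decides membership.\<close>
      have others: "a j \<bullet> z < b j * s" if "j \<in> {1..n} - {i}" "?r \<le> s" for j s
      proof -
        have "a j \<bullet> z < b j * ?r" using z(1) that(1) by (auto simp: K_def)
        also have "\<dots> \<le> b j * s" using bspec[OF b, of j] that by auto
        finally show ?thesis .
      qed
      have split: "(\<forall>j\<in>{1..n}. Q j) \<longleftrightarrow> Q i \<and> (\<forall>j\<in>{1..n} - {i}. Q j)" for Q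
        using i(1) by auto
      show "?r \<in> \<int>"
      proof (rule entry[OF z(2) r])
        fix s :: real assume s: "s > 0"
        have "(1 / s) *\<^sub>R z \<in> P \<longleftrightarrow> (\<forall>j\<in>{1..n}. a j \<bullet> z \<le> b j * s)"
          using s by (simp add: P pos_divide_le_eq)
        also have "\<dots> \<longleftrightarrow> ?r \<le> s"
          unfolding split using i(2) others by (auto intro: less_imp_le)
        finally show "(1 / s) *\<^sub>R z \<in> P \<longleftrightarrow> ?r \<le> s" .
        have "(1 / s) *\<^sub>R z \<in> interior P \<longleftrightarrow> (\<forall>j\<in>{1..n}. a j \<bullet> z < b j * s)"
          using s by (simp add: int pos_divide_less_eq)
        also have "\<dots> \<longleftrightarrow> ?r < s"
          unfolding split using i(2) others[OF _ less_imp_le, of _ s] by (metis mult_1)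
        finally show "(1 / s) *\<^sub>R z \<in> interior P \<longleftrightarrow> ?r < s" .
      qed
    qed
  qed
  then have "semi_reflexive_system P n a b"
    using P b by (auto simp: semi_reflexive_system_def)
  then show ?thesis by blast
qed

section \<open>From the closed counts to the inequalities\<close>

text \<open>The convention at 0 forces exactly one lattice point in each dilate with
  \<open>0 < s < 1\<close>; for small \<open>s\<close> it can only be the origin, so
  \<open>0 \<in> P\<close>. Convexity then nests the dilates.\<close>

lemma count_imp_semi_reflexive:
  fixes P :: "(real ^ 'n) set"
  assumes "polytope P" "aff_dim P = int CARD('n)"
    and count: "\<And>s. s \<ge> 0 \<Longrightarrow> lattice_count P s = lattice_count P (of_int \<lfloor>s\<rfloor>)"
  shows "\<exists>n a b. semi_reflexive_system P n a b"
proof -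
  have bdd: "bounded P" and conv: "convex P" and poly: "polyhedron P"
    using assms(1) polytope_imp_bounded polytope_imp_convex polytope_imp_polyhedron by auto
  have card1: "card (dilate_lattice_points P s) = 1" if "0 < s" "s < 1" for s
  proof -
    have "\<lfloor>s\<rfloor> = 0" using that by (simp add: floor_eq_iff)
    then have "lattice_count P s = 1" using count[of s] that by (simp add: lattice_count_def)
    then show ?thesis using that by (simp add: lattice_count_eq_card)
  qed
  obtain M where M: "M > 0" "\<And>x. x \<in> P \<Longrightarrow> norm x \<le> M"
    using bdd bounded_pos by blast
  \<comment> \<open>Chosen so that points of the dilate by \<open>e\<close> have norm at most
    \<open>M * e < 1\<close>.\<close>
  define e where "e = 1 / (M + 1)"
  have e: "0 < e" "e < 1" using M(1) by (auto simp: e_def)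
  obtain z where z: "z \<in> integer_lattice" "(1 / e) *\<^sub>R z \<in> P"
    using card1[OF e] by (auto simp: card_1_singleton_iff dilate_lattice_points_def)
  have "norm z \<le> M * e" using M(2)[OF z(2)] e by (simp add: pos_divide_le_eq)
  also have "M * e < 1" using M(1) by (simp add: e_def)
  finally have "norm z < 1" .
  then have "z = 0" by (rule integer_lattice_norm_less_1[OF z(1)])
  then have P0: "0 \<in> P" using z(2) by simp
  show ?thesis
  proof (rule semi_reflexive_if_integer_entry_times[OF poly assms(2) P0])
    fix z :: "real ^ 'n" and r :: real
    assume z: "z \<in> integer_lattice" and r: "r > 0"
      and entry: "\<And>s. s > 0 \<Longrightarrow> (1 / s) *\<^sub>R z \<in> P \<longleftrightarrow> r \<le> s"
    have zr: "z \<in> dilate_lattice_points P r"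
      using z entry[OF r] by (simp add: dilate_lattice_points_def)
    show "r \<in> \<int>"
    proof (cases "r < 1")
      case True
      \<comment> \<open>The only lattice point is then the origin, which lies in all dilates and so
        has no positive entry time.\<close>
      have "0 \<in> dilate_lattice_points P r"
        using P0 by (simp add: dilate_lattice_points_def integer_lattice_def)
      with zr card1[OF r True] have "z = 0" by (auto simp: card_1_singleton_iff)
      with entry[of "r / 2"] P0 r show ?thesis by simp
    next
      case False
      let ?k = "real_of_int \<lfloor>r\<rfloor>"
      have k: "?k > 0" "?k \<le> r" using False by auto
      have "dilate_lattice_points P ?k \<subseteq> dilate_lattice_points P r"
      proof -
        have "(1 / r) *\<^sub>R x \<in> P" if "(1 / ?k) *\<^sub>R x \<in> P" for x
        proof -
          have "(?k / r) *\<^sub>R ((1 / ?k) *\<^sub>R x) + (1 - ?k / r) *\<^sub>R 0 \<in> P"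
            using k r by (intro convexD[OF conv that P0]) auto
          then show ?thesis using k by simp
        qed
        then show ?thesis by (auto simp: dilate_lattice_points_def)
      qed
      then have "dilate_lattice_points P ?k = dilate_lattice_points P r"
        using count[of r] r k finite_dilate_lattice_points[OF bdd, of r]
        by (intro card_subset_eq) (auto simp: lattice_count_eq_card)
      with zr have "z \<in> dilate_lattice_points P ?k" by simp
      then have "(1 / ?k) *\<^sub>R z \<in> P" by (simp add: dilate_lattice_points_def)
      with entry k have "r = ?k" by (intro antisym) auto
      then show ?thesis by (metis Ints_of_int)
    qed
  qed
qed

section \<open>From the interior counts to the inequalities\<close>

text \<open>
  No lattice point ever leaves the open dilates: to the left of the first time at which it is
  missing, the finitely many lattice points of the open dilate are all present already,
  so an additional point would make the count larger.
\<close>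
lemma open_dilate_lattice_points_persist:
  fixes U :: "(real ^ 'n) set"
  assumes U: "open U" "bounded U"
    and count: "\<And>s. s \<ge> 0 \<Longrightarrow> lattice_count U s = lattice_count U (of_int \<lceil>s\<rceil>)"
    and z: "z \<in> dilate_lattice_points U s" and s: "0 < s" "s \<le> t"
  shows "z \<in> dilate_lattice_points U t"
proof (rule ccontr)
  assume "z \<notin> dilate_lattice_points U t"
  \<comment> \<open>The times at which \<open>z\<close> is missing. Openness of \<open>U\<close>
    makes \<open>T\<close> closed, so there is a first such time \<open>m\<close>, and it comes
    after \<open>s\<close>.\<close>
  define T where "T = {r \<in> {s..t}. (1 / r) *\<^sub>R z \<notin> U}"
  have zL: "z \<in> integer_lattice" using z by (simp add: dilate_lattice_points_def)
  have "t \<in> T" using \<open>z \<notin> _\<close> s zL by (auto simp: T_def dilate_lattice_points_def)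
  have "closed T"
  proof -
    have "continuous_on {s..t} (\<lambda>r. (1 / r) *\<^sub>R z)"
      using s by (intro continuous_intros) auto
    then have "closed ({s..t} \<inter> (\<lambda>r. (1 / r) *\<^sub>R z) -` (- U))"
      using U(1) by (intro continuous_closed_preimage) auto
    moreover have "{s..t} \<inter> (\<lambda>r. (1 / r) *\<^sub>R z) -` (- U) = T" by (auto simp: T_def)
    ultimately show ?thesis by simp
  qed
  define m where "m = Inf T"
  have bddT: "bdd_below T" by (auto simp: T_def intro: bdd_belowI[of _ s])
  have "m \<in> T" unfolding m_def
    using \<open>t \<in> T\<close> \<open>closed T\<close> bddT by (intro closed_contains_Inf) auto
  moreover have "(1 / s) *\<^sub>R z \<in> U" using z by (simp add: dilate_lattice_points_def)
  ultimately have m: "s < m" "m \<le> t" "(1 / m) *\<^sub>R z \<notin> U"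
    by (auto simp: T_def order_less_le)
  have before: "(1 / r) *\<^sub>R z \<in> U" if "s \<le> r" "r < m" for r
    using cInf_lower[OF _ bddT, of r] that m by (force simp: T_def m_def)
  let ?S = "dilate_lattice_points U"
  have fin: "finite (?S m)" using finite_dilate_lattice_points[OF U(2)] m s by auto
  have "eventually (\<lambda>r. (1 / r) *\<^sub>R x \<in> U) (at_left m)" if "x \<in> ?S m" for x
  proof -
    have "((\<lambda>r. (1 / r) *\<^sub>R x) \<longlongrightarrow> (1 / m) *\<^sub>R x) (at_left m)"
      using m s by (intro tendsto_intros) auto
    then show ?thesis
      using topological_tendstoD U(1) that by (auto simp: dilate_lattice_points_def)
  qed
  then have "eventually (\<lambda>r. \<forall>x\<in>?S m. (1 / r) *\<^sub>R x \<in> U) (at_left m)"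
    using fin by (simp add: eventually_ball_finite)
  \<comment> \<open>Above \<open>\<lceil>m\<rceil> - 1\<close> the ceiling, hence the count, is the
    same as at \<open>m\<close>; between \<open>s\<close> and \<open>m\<close> the point
    \<open>z\<close> is still present.\<close>
  moreover have "max s (of_int \<lceil>m\<rceil> - 1) < m" using m by (simp, linarith)
  then have "eventually (\<lambda>r. r \<in> {max s (of_int \<lceil>m\<rceil> - 1) <..< m}) (at_left m)"
    by (rule eventually_at_leftI[rotated])
  ultimately have "eventually (\<lambda>r. (\<forall>x\<in>?S m. (1 / r) *\<^sub>R x \<in> U) \<and>
      r \<in> {max s (of_int \<lceil>m\<rceil> - 1) <..< m}) (at_left m)"
    by (rule eventually_conj)
  then obtain r where r: "\<forall>x\<in>?S m. (1 / r) *\<^sub>R x \<in> U"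
      "r \<in> {max s (of_int \<lceil>m\<rceil> - 1) <..< m}"
    using eventually_happens'[OF trivial_limit_at_left_real] by blast
  have "\<lceil>r\<rceil> = \<lceil>m\<rceil>" using r(2) by (intro ceiling_unique; simp; linarith)
  then have "lattice_count U r = lattice_count U m"
    using count[of r] count[of m] r(2) m s by auto
  then have "card (?S m) = card (?S r)" using r(2) m s by (auto simp: lattice_count_eq_card)
  moreover have "?S m \<subseteq> ?S r" using r(1) by (auto simp: dilate_lattice_points_def)
  moreover have "finite (?S r)" using finite_dilate_lattice_points[OF U(2)] r(2) s by auto
  ultimately have "?S m = ?S r" by (intro card_subset_eq) auto
  moreover have "z \<in> ?S r" using before r(2) zL by (auto simp: dilate_lattice_points_def)
  ultimately show False using m(3) by (auto simp: dilate_lattice_points_def)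
qed

text \<open>A lattice point \<open>z\<close> of some open dilate persists in all later ones, so
  \<open>(1 / s) *\<^sub>R z\<close> stays in the closed set \<open>P\<close> while tending to 0;
  hence \<open>0 \<in> P\<close>. Persistence also nests the open dilates.\<close>

lemma interior_count_imp_semi_reflexive:
  fixes P :: "(real ^ 'n) set"
  assumes "polytope P" "aff_dim P = int CARD('n)"
    and count: "\<And>s. s \<ge> 0 \<Longrightarrow>
      lattice_count (interior P) s = lattice_count (interior P) (of_int \<lceil>s\<rceil>)"
  shows "\<exists>n a b. semi_reflexive_system P n a b"
proof -
  have bdd: "bounded (interior P)" and poly: "polyhedron P" and "closed P" and "convex P"
    using assms(1) polytope_imp_bounded polytope_imp_polyhedron polytope_imp_closed
      polytope_imp_convex bounded_interior by auto
  note persist = open_dilate_lattice_points_persist[OF open_interior bdd count]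
  have "P \<noteq> {}" using assms(2) by auto
  then have "interior P \<noteq> {}"
    using assms(2) interior_rel_interior[of P] \<open>convex P\<close> rel_interior_eq_empty[of P] by auto
  then obtain t z where t: "t > 0" and z: "z \<in> integer_lattice" "(1 / t) *\<^sub>R z \<in> interior P"
    using open_contains_scaled_integer_vectors[OF open_interior] by blast
  have later: "(1 / s) *\<^sub>R z \<in> P" if "s \<ge> t" for s
    using persist[of z t s] z t that interior_subset by (auto simp: dilate_lattice_points_def)
  have "((\<lambda>s. (1 / s) *\<^sub>R z) \<longlongrightarrow> 0 *\<^sub>R z) at_top"
    by (intro tendsto_intros tendsto_divide_0[OF tendsto_const] filterlim_at_top_imp_at_infinity
        filterlim_ident)
  then have P0: "0 \<in> P"
    using Lim_in_closed_set[OF \<open>closed P\<close>, of "\<lambda>s. (1 / s) *\<^sub>R z" at_top] later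
    by (auto simp: eventually_at_top_linorder)
  show ?thesis
  proof (rule semi_reflexive_if_integer_entry_times[OF poly assms(2) P0])
    fix z :: "real ^ 'n" and r :: real
    assume z: "z \<in> integer_lattice" and r: "r > 0"
      and entry: "\<And>s. s > 0 \<Longrightarrow> (1 / s) *\<^sub>R z \<in> interior P \<longleftrightarrow> r < s"
    let ?k = "real_of_int \<lceil>r\<rceil>"
    have k: "?k > 0" "r \<le> ?k" using r by auto
    show "r \<in> \<int>"
    proof (rule ccontr)
      \<comment> \<open>At time \<open>?k > r\<close> the point is interior; nesting and equal
        counts would place it in the open dilate at \<open>r\<close> already, against strict
        entry.\<close>
      assume "r \<notin> \<int>"
      then have "r < ?k" using k by (metis Ints_of_int order_less_le)
      have "dilate_lattice_points (interior P) r \<subseteq> dilate_lattice_points (interior P) ?k"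
        using persist r k by blast
      then have "dilate_lattice_points (interior P) r = dilate_lattice_points (interior P) ?k"
        using count[of r] r k finite_dilate_lattice_points[OF bdd less_imp_neq[OF k(1), THEN not_sym]]
        by (intro card_subset_eq) (simp_all add: lattice_count_eq_card)
      then have "(1 / r) *\<^sub>R z \<in> interior P"
        using z entry[of ?k] k \<open>r < ?k\<close> by (auto simp: dilate_lattice_points_def)
      with entry[OF r] show False by simp
    qed
  qed
qed

theorem theorem6:
  fixes P :: "(real ^ 'n) set"
  assumes "polytope P"
    and "aff_dim P = int CARD('n)"
  shows "((\<forall>s::real. s \<ge> 0 \<longrightarrow>
             lattice_count (interior P) s = lattice_count (interior P) (of_int \<lceil>s\<rceil>))
          \<longleftrightarrow>
          (\<exists>(n::nat) (a :: nat \<Rightarrow> real ^ 'n) (b :: nat \<Rightarrow> real).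
             P = (\<Inter>i\<in>{1..n}. {x. a i \<bullet> x \<le> b i}) \<and>
             (\<forall>i\<in>{1..n}. (b i = 0 \<or> b i = 1) \<and>
                         (b i = 1 \<longrightarrow> a i \<in> integer_lattice))))
         \<and>
         ((\<forall>s::real. s \<ge> 0 \<longrightarrow>
             lattice_count P s = lattice_count P (of_int \<lfloor>s\<rfloor>))
          \<longleftrightarrow>
          (\<forall>s::real. s \<ge> 0 \<longrightarrow>
             lattice_count (interior P) s = lattice_count (interior P) (of_int \<lceil>s\<rceil>)))"
proof -
  have bdd: "bounded P" using assms(1) by (rule polytope_imp_bounded)
  \<comment> \<open>Each counting condition is equivalent to the existence of a system, which links
    the two conditions to each other.\<close>
  show ?thesis
    unfolding semi_reflexive_system_def[symmetric]
    using semi_reflexive_imp_interior_count[of P] semi_reflexive_imp_count[of P, OF _ bdd]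
      interior_count_imp_semi_reflexive[OF assms] count_imp_semi_reflexive[OF assms]
    by metis
qed

end
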